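(* The semigroup $T_{\mathbb{S}(I)}(X,\mathcal{P})$ is an inverse semigroup if and only if: (i) $\mathbb{S}(I)$ is an inverse semigroup; and (ii) for each $\alpha\in E(\mathbb{S}(I))$, we have $|X_i|=1$ for all $i\in I\alpha$.
   Context: $X$ is a nonempty set (possibly infinite) and $\mathcal{P}=\{X_i : i\in I\}$ is a partition of $X$ into nonempty blocks, with $X_i\cap X_j=\varnothing$ for $i\neq j$. $T(Z)$ denotes the semigroup of all maps $Z\to Z$ under composition. Maps are written on the right and composed from left to right: $x(fg)=(xf)g$; $Af=\{af: a\in A\}$. $T(X,\mathcal{P})$ is the subsemigroup of all $f\in T(X)$ such that for every $i\in I$ there is $j\in I$ with $X_if\subseteq X_j$. For $f\in T(X,\mathcal{P})$ the character $\chi^{(f)}\in T(I)$ is defined by $i\chi^{(f)}=j$ whenever $X_if\subseteq X_j$. $\mathbb{S}(I)$ is an arbitrary subsemigroup of $T(I)$, and $T_{\mathbb{S}(I)}(X,\mathcal{P})=\{f\in T(X,\mathcal{P}): \chi^{(f)}\in \mathbb{S}(I)\}$, a subsemigroup of $T(X,\mathcal{P})$. For a semigroup $S$, $E(S)=\{a\in S: a^2=a\}$. A semigroup $S$ is an inverse semigroup if for every $x\in S$ there is a unique $y\in S$ with $xyx=x$ and $yxy=y$. *)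

theory Defs
  imports Main "HOL-Library.FuncSet" "HOL-Library.Disjoint_Sets"
begin

text \<open>Semigroups are carrier sets together with a binary operation.  The carrier is allowed to
  be empty.\<close>

definition semigroup_on :: "'c set \<Rightarrow> ('c \<Rightarrow> 'c \<Rightarrow> 'c) \<Rightarrow> bool" where
  "semigroup_on S m \<longleftrightarrow>
     (\<forall>x\<in>S. \<forall>y\<in>S. m x y \<in> S) \<and>
     (\<forall>x\<in>S. \<forall>y\<in>S. \<forall>z\<in>S. m (m x y) z = m x (m y z))"

definition subsemigroup_on :: "'c set \<Rightarrow> 'c set \<Rightarrow> ('c \<Rightarrow> 'c \<Rightarrow> 'c) \<Rightarrow> bool" where
  "subsemigroup_on H S m \<longleftrightarrow> H \<subseteq> S \<and> (\<forall>x\<in>H. \<forall>y\<in>H. m x y \<in> H)"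

definition inverse_semigroup_on :: "'c set \<Rightarrow> ('c \<Rightarrow> 'c \<Rightarrow> 'c) \<Rightarrow> bool" where
  "inverse_semigroup_on S m \<longleftrightarrow>
     semigroup_on S m \<and>
     (\<forall>x\<in>S. \<exists>!y. y \<in> S \<and> m (m x y) x = x \<and> m (m y x) y = y)"

definition idempotents :: "'c set \<Rightarrow> ('c \<Rightarrow> 'c \<Rightarrow> 'c) \<Rightarrow> 'c set" where
  "idempotents S m = {a \<in> S. m a a = a}"

text \<open>A map from \<open>Z\<close> to \<open>Z\<close> is represented by the unique function that agrees with it on \<open>Z\<close>
  and is \<open>undefined\<close> outside \<open>Z\<close>, so that equality of functions is equality of maps on \<open>Z\<close>.\<close>

definition transf :: "'a set \<Rightarrow> ('a \<Rightarrow> 'a) set" where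
  "transf Z = Z \<rightarrow>\<^sub>E Z"

text \<open>Maps act on the right: the product \<open>f g\<close> applies \<open>f\<close> first, whereas
  \<open>compose Z g f\<close> is \<open>g\<close> after \<open>f\<close>.\<close>

definition tmult :: "'a set \<Rightarrow> ('a \<Rightarrow> 'a) \<Rightarrow> ('a \<Rightarrow> 'a) \<Rightarrow> ('a \<Rightarrow> 'a)" where
  "tmult Z f g = compose Z g f"

definition indexed_partition :: "'a set \<Rightarrow> 'i set \<Rightarrow> ('i \<Rightarrow> 'a set) \<Rightarrow> bool" where
  "indexed_partition X I P \<longleftrightarrow>
     (\<Union>i\<in>I. P i) = X \<and> (\<forall>i\<in>I. P i \<noteq> {}) \<and> disjoint_family_on P I"

definition transf_partition :: "'a set \<Rightarrow> 'i set \<Rightarrow> ('i \<Rightarrow> 'a set) \<Rightarrow> ('a \<Rightarrow> 'a) set" where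
  "transf_partition X I P = {f \<in> transf X. \<forall>i\<in>I. \<exists>j\<in>I. f ` P i \<subseteq> P j}"

text \<open>For \<open>f \<in> transf_partition X I P\<close> and \<open>i \<in> I\<close> the index \<open>j\<close> below exists, and it is unique
  because the blocks are nonempty and pairwise disjoint.\<close>

definition character :: "'i set \<Rightarrow> ('i \<Rightarrow> 'a set) \<Rightarrow> ('a \<Rightarrow> 'a) \<Rightarrow> ('i \<Rightarrow> 'i)" where
  "character I P f = (\<lambda>i\<in>I. THE j. j \<in> I \<and> f ` P i \<subseteq> P j)"

definition transf_character ::
    "'a set \<Rightarrow> 'i set \<Rightarrow> ('i \<Rightarrow> 'a set) \<Rightarrow> ('i \<Rightarrow> 'i) set \<Rightarrow> ('a \<Rightarrow> 'a) set" where
  "transf_character X I P S = {f \<in> transf_partition X I P. character I P f \<in> S}"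

end

theory Submission imports Defs begin

text \<open>
  Write \<open>T\<close> for the semigroup of all block-respecting maps whose character lies in \<open>S\<close>.  Taking
  characters is a homomorphism from \<open>T\<close> to \<open>S\<close>, and it splits: once a representative \<open>r j\<close> of
  every block \<open>P j\<close> is fixed, the map \<open>lift r \<alpha>\<close> collapsing each block \<open>P i\<close> to the point
  \<open>r (\<alpha> i)\<close> has character \<open>\<alpha>\<close>, and \<open>\<alpha> \<mapsto> lift r \<alpha>\<close> is a homomorphism.  So \<open>S\<close> is a retract of
  \<open>T\<close>, and a retract of an inverse semigroup is an inverse semigroup (\<open>inverse_semigroup_retract\<close>).
  This gives condition (i) from the left-hand side.

  Condition (ii) comes from varying the representatives.  If \<open>\<alpha>\<close> is idempotent, then
  \<open>lift r \<alpha>\<close> and \<open>lift s \<alpha>\<close> form a right zero band, so each is an inverse of \<open>lift r \<alpha>\<close>.  Since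
  inverses in \<open>T\<close> are unique, these lifts agree, so the blocks indexed by the image of \<open>\<alpha>\<close> leave no
  freedom in the choice of a representative.

  Conversely, in an inverse semigroup \<open>S\<close> every \<open>\<alpha>\<close> has the same image as the idempotent
  \<open>\<beta>\<alpha>\<close>, where \<open>\<beta>\<close> is its inverse, so by (ii) every block that meets the image of a map in \<open>T\<close> is a singleton.  Hence each
  map in \<open>T\<close> is the lift of its character (\<open>lift_character\<close>), the two homomorphisms are mutually
  inverse, and now \<open>T\<close> is a retract of \<open>S\<close>.
\<close>

text \<open>Existence of an inverse is carried over by the retraction \<open>\<phi>\<close>, uniqueness and associativity
  by the injectivity of the section \<open>\<sigma>\<close>.\<close>

lemma inverse_semigroup_retract:
  assumes inv: "inverse_semigroup_on A m"
    and \<phi>: "\<And>a. a \<in> A \<Longrightarrow> \<phi> a \<in> B"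
      "\<And>a b. a \<in> A \<Longrightarrow> b \<in> A \<Longrightarrow> \<phi> (m a b) = n (\<phi> a) (\<phi> b)"
    and \<sigma>: "\<And>x. x \<in> B \<Longrightarrow> \<sigma> x \<in> A"
      "\<And>x y. x \<in> B \<Longrightarrow> y \<in> B \<Longrightarrow> \<sigma> (n x y) = m (\<sigma> x) (\<sigma> y)"
    and retract: "\<And>x. x \<in> B \<Longrightarrow> \<phi> (\<sigma> x) = x"
  shows "inverse_semigroup_on B n"
proof -
  have m_closed: "m a b \<in> A" if "a \<in> A" "b \<in> A" for a b
    using inv that unfolding inverse_semigroup_on_def semigroup_on_def by blast
  have m_assoc: "m (m a b) c = m a (m b c)" if "a \<in> A" "b \<in> A" "c \<in> A" for a b c
    using inv that unfolding inverse_semigroup_on_def semigroup_on_def by blast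
  have n_closed: "n x y \<in> B" if "x \<in> B" "y \<in> B" for x y
    using \<phi>(1)[OF m_closed[OF \<sigma>(1)[OF that(1)] \<sigma>(1)[OF that(2)]]] that
    by (simp add: \<phi>(2) \<sigma>(1) retract)
  have \<sigma>_eq: "x = y" if "x \<in> B" "y \<in> B" "\<sigma> x = \<sigma> y" for x y
    using retract that by metis
  have n_assoc: "n (n x y) z = n x (n y z)" if "x \<in> B" "y \<in> B" "z \<in> B" for x y z
    using that by (intro \<sigma>_eq) (simp_all add: n_closed \<sigma> m_assoc)
  have "\<exists>!y. y \<in> B \<and> n (n x y) x = x \<and> n (n y x) y = y" if x: "x \<in> B" for x
  proof -
    have unique: "\<exists>!b. b \<in> A \<and> m (m (\<sigma> x) b) (\<sigma> x) = \<sigma> x \<and> m (m b (\<sigma> x)) b = b"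
      using inv \<sigma>(1)[OF x] unfolding inverse_semigroup_on_def by blast
    then obtain b where b: "b \<in> A" "m (m (\<sigma> x) b) (\<sigma> x) = \<sigma> x" "m (m b (\<sigma> x)) b = b"
      by blast
    have "n (n x (\<phi> b)) x = \<phi> (m (m (\<sigma> x) b) (\<sigma> x))"
      using x b(1) by (simp add: \<phi>(2) \<sigma>(1) m_closed retract)
    moreover have "n (n (\<phi> b) x) (\<phi> b) = \<phi> (m (m b (\<sigma> x)) b)"
      using x b(1) by (simp add: \<phi>(2) \<sigma>(1) m_closed retract)
    ultimately have ex: "\<phi> b \<in> B \<and> n (n x (\<phi> b)) x = x \<and> n (n (\<phi> b) x) (\<phi> b) = \<phi> b"
      using b x by (simp add: \<phi>(1) retract)
    have \<sigma>_inverse: "\<sigma> y \<in> A \<and> m (m (\<sigma> x) (\<sigma> y)) (\<sigma> x) = \<sigma> x \<and> m (m (\<sigma> y) (\<sigma> x)) (\<sigma> y) = \<sigma> y"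
      if "y \<in> B \<and> n (n x y) x = x \<and> n (n y x) y = y" for y
      using that x \<sigma> n_closed by metis
    have "y = y'" if "y \<in> B \<and> n (n x y) x = x \<and> n (n y x) y = y"
      and "y' \<in> B \<and> n (n x y') x = x \<and> n (n y' x) y' = y'" for y y'
      using unique \<sigma>_inverse[OF that(1)] \<sigma>_inverse[OF that(2)] that \<sigma>_eq by blast
    with ex show ?thesis by blast
  qed
  then show ?thesis
    unfolding inverse_semigroup_on_def semigroup_on_def
    using n_closed n_assoc by blast
qed

lemma tmult_apply: "x \<in> Z \<Longrightarrow> tmult Z f g x = g (f x)"
  by (simp add: tmult_def compose_def)

lemma tmult_extensional: "tmult Z f g \<in> extensional Z"
  by (simp add: tmult_def compose_extensional)

locale partitioned_set =
  fixes X :: "'a set" and I :: "'i set" and P :: "'i \<Rightarrow> 'a set"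
  assumes partition: "indexed_partition X I P"
begin

definition block :: "'a \<Rightarrow> 'i" where
  "block x = (THE i. i \<in> I \<and> x \<in> P i)"

definition lift :: "('i \<Rightarrow> 'a) \<Rightarrow> ('i \<Rightarrow> 'i) \<Rightarrow> 'a \<Rightarrow> 'a" where
  "lift r \<alpha> = (\<lambda>x\<in>X. r (\<alpha> (block x)))"

lemma block_unique: "i \<in> I \<Longrightarrow> j \<in> I \<Longrightarrow> x \<in> P i \<Longrightarrow> x \<in> P j \<Longrightarrow> i = j"
  using partition unfolding indexed_partition_def disjoint_family_on_def by blast

lemma block_eq: "i \<in> I \<Longrightarrow> x \<in> P i \<Longrightarrow> block x = i"
  unfolding block_def by (rule the_equality) (blast intro: block_unique)+

lemma block_nonempty: "i \<in> I \<Longrightarrow> P i \<noteq> {}"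
  using partition unfolding indexed_partition_def by blast

lemma representatives:
  obtains r where "\<And>i. i \<in> I \<Longrightarrow> r i \<in> P i"
proof -
  have "\<exists>r. \<forall>i\<in>I. r i \<in> P i"
    using block_nonempty by (intro bchoice) blast
  then show thesis using that by blast
qed

lemma in_X: "i \<in> I \<Longrightarrow> x \<in> P i \<Longrightarrow> x \<in> X"
  using partition unfolding indexed_partition_def by blast

lemma block_mem: "x \<in> X \<Longrightarrow> block x \<in> I \<and> x \<in> P (block x)"
  using partition by (auto simp: indexed_partition_def block_eq)

lemma character_eqI:
  assumes "i \<in> I" "j \<in> I" "f ` P i \<subseteq> P j"
  shows "character I P f i = j"
proof -
  have "k = j" if "k \<in> I" "f ` P i \<subseteq> P k" for k
    using that assms block_nonempty[OF assms(1)] block_unique by blast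
  then have "(THE k. k \<in> I \<and> f ` P i \<subseteq> P k) = j"
    using assms(2,3) by (intro the_equality) blast+
  then show ?thesis using assms by (simp add: character_def)
qed

lemma character_mem:
  assumes "f \<in> transf_partition X I P" "i \<in> I"
  shows "character I P f i \<in> I" "f ` P i \<subseteq> P (character I P f i)"
proof -
  obtain j where "j \<in> I" "f ` P i \<subseteq> P j"
    using assms by (auto simp: transf_partition_def)
  then show "character I P f i \<in> I" "f ` P i \<subseteq> P (character I P f i)"
    using character_eqI[OF assms(2)] by simp_all
qed

lemma tmult_transf_partition:
  assumes "f \<in> transf_partition X I P" "g \<in> transf_partition X I P"
  shows "tmult X f g \<in> transf_partition X I P"
    and "character I P (tmult X f g) = tmult I (character I P f) (character I P g)"
proof -
  let ?\<chi> = "character I P"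
  have image: "tmult X f g ` P i \<subseteq> P (?\<chi> g (?\<chi> f i))" if "i \<in> I" for i
  proof (rule image_subsetI)
    fix x assume x: "x \<in> P i"
    have "f x \<in> P (?\<chi> f i)"
      using character_mem(2)[OF assms(1) that] x by blast
    then have "g (f x) \<in> P (?\<chi> g (?\<chi> f i))"
      using character_mem(2)[OF assms(2) character_mem(1)[OF assms(1) that]] by blast
    then show "tmult X f g x \<in> P (?\<chi> g (?\<chi> f i))"
      using in_X[OF that x] by (simp add: tmult_apply)
  qed
  have index: "?\<chi> g (?\<chi> f i) \<in> I" if "i \<in> I" for i
    using that assms by (simp add: character_mem)
  have "tmult X f g \<in> transf X"
    using assms unfolding transf_partition_def transf_def
    by (auto simp: tmult_apply PiE_iff tmult_extensional)
  then show "tmult X f g \<in> transf_partition X I P"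
    using image index unfolding transf_partition_def by blast
  show "?\<chi> (tmult X f g) = tmult I (?\<chi> f) (?\<chi> g)"
  proof (rule extensionalityI)
    show "?\<chi> (tmult X f g) \<in> extensional I" by (simp add: character_def)
    show "tmult I (?\<chi> f) (?\<chi> g) \<in> extensional I" by (rule tmult_extensional)
    show "?\<chi> (tmult X f g) i = tmult I (?\<chi> f) (?\<chi> g) i" if "i \<in> I" for i
      using character_eqI[OF that index image] that by (simp add: tmult_apply)
  qed
qed

lemma lift_transf_partition:
  assumes r: "\<And>i. i \<in> I \<Longrightarrow> r i \<in> P i" and \<alpha>: "\<alpha> \<in> transf I"
  shows "lift r \<alpha> \<in> transf_partition X I P" and "character I P (lift r \<alpha>) = \<alpha>"
proof -
  have \<alpha>I: "\<alpha> i \<in> I" if "i \<in> I" for i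
    using \<alpha> that by (auto simp: transf_def)
  have image: "lift r \<alpha> ` P i \<subseteq> P (\<alpha> i)" if "i \<in> I" for i
    using that r \<alpha>I in_X by (auto simp: lift_def block_eq)
  have "lift r \<alpha> \<in> transf X"
    unfolding transf_def lift_def using block_mem \<alpha>I r in_X by (simp add: PiE_iff) blast
  then show "lift r \<alpha> \<in> transf_partition X I P"
    using image \<alpha>I unfolding transf_partition_def by blast
  show "character I P (lift r \<alpha>) = \<alpha>"
  proof (rule extensionalityI)
    show "character I P (lift r \<alpha>) \<in> extensional I" by (simp add: character_def)
    show "\<alpha> \<in> extensional I" using \<alpha> by (simp add: transf_def PiE_iff)
    show "character I P (lift r \<alpha>) i = \<alpha> i" if "i \<in> I" for i
      using that by (simp add: character_eqI image \<alpha>I)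
  qed
qed

text \<open>The second factor forgets everything about its argument except the block, so the
  representatives used by the first factor leave no trace.  With \<open>r = s\<close> lifting is a homomorphism;
  with \<open>r \<noteq> s\<close> the lifts of one idempotent form a right zero band.\<close>

lemma tmult_lift:
  assumes r: "\<And>i. i \<in> I \<Longrightarrow> r i \<in> P i" and \<alpha>: "\<alpha> \<in> transf I"
  shows "tmult X (lift r \<alpha>) (lift s \<beta>) = lift s (tmult I \<alpha> \<beta>)"
proof (rule extensionalityI[where A = X])
  show "tmult X (lift r \<alpha>) (lift s \<beta>) x = lift s (tmult I \<alpha> \<beta>) x" if x: "x \<in> X" for x
  proof -
    have i: "block x \<in> I" using block_mem[OF x] by simp
    then have j: "\<alpha> (block x) \<in> I" using \<alpha> by (auto simp: transf_def)
    then show ?thesis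
      using x i in_X[OF j r[OF j]] block_eq[OF j r[OF j]] by (simp add: tmult_apply lift_def)
  qed
qed (simp_all add: tmult_extensional lift_def)

text \<open>Where the target block has a single point, the character leaves the map no choice.  This is
  what makes lifting a two-sided inverse of taking characters.\<close>

lemma lift_character:
  assumes r: "\<And>i. i \<in> I \<Longrightarrow> r i \<in> P i" and f: "f \<in> transf_partition X I P"
    and singleton: "\<And>i. i \<in> character I P f ` I \<Longrightarrow> card (P i) = 1"
  shows "lift r (character I P f) = f"
proof (rule extensionalityI[where A = X])
  show "f \<in> extensional X"
    using f by (simp add: transf_partition_def transf_def PiE_iff)
  show "lift r (character I P f) x = f x" if x: "x \<in> X" for x
  proof -
    let ?j = "character I P f (block x)"
    have i: "block x \<in> I" "x \<in> P (block x)" using block_mem[OF x] by auto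
    have "f x \<in> P ?j" "r ?j \<in> P ?j"
      using character_mem[OF f i(1)] i(2) r by auto
    moreover obtain c where "P ?j = {c}"
      using singleton[of ?j] i(1) by (auto simp: card_1_singleton_iff)
    ultimately show ?thesis using x by (simp add: lift_def)
  qed
qed (simp add: lift_def)

text \<open>Two points \<open>a\<close> and \<open>b\<close> of a block in the image give two lifts of \<open>\<alpha>\<close> that are both
  inverses of the first one, hence equal; evaluating them in that block gives \<open>a = b\<close>.\<close>

lemma idempotent_image_singleton:
  assumes S: "S \<subseteq> transf I"
    and inv: "inverse_semigroup_on (transf_character X I P S) (tmult X)"
    and \<alpha>: "\<alpha> \<in> idempotents S (tmult I)" and i: "i \<in> \<alpha> ` I"
  shows "card (P i) = 1"
proof -
  have \<alpha>S: "\<alpha> \<in> S" and idem: "tmult I \<alpha> \<alpha> = \<alpha>" using \<alpha> by (auto simp: idempotents_def)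
  have \<alpha>I: "\<alpha> \<in> transf I" using \<alpha>S S by blast
  obtain k where k: "k \<in> I" "i = \<alpha> k" using i by blast
  then have iI: "i \<in> I" using \<alpha>I by (auto simp: transf_def)
  have fixed: "\<alpha> i = i" using idem k by (metis tmult_apply)
  obtain r where r: "\<And>j. j \<in> I \<Longrightarrow> r j \<in> P j"
    by (rule representatives) blast
  have "a = b" if ab: "a \<in> P i" "b \<in> P i" for a b
  proof -
    define f where "f = lift (r(i := a)) \<alpha>"
    define g where "g = lift (r(i := b)) \<alpha>"
    have ra: "(r(i := a)) j \<in> P j" and rb: "(r(i := b)) j \<in> P j" if "j \<in> I" for j
      using r ab that by auto
    have in_T: "f \<in> transf_character X I P S" "g \<in> transf_character X I P S"
      unfolding f_def g_def transf_character_def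
      using lift_transf_partition[of "r(i := a)", OF ra \<alpha>I]
        lift_transf_partition[of "r(i := b)", OF rb \<alpha>I] \<alpha>S by auto
    have "tmult X f f = f" "tmult X f g = g" "tmult X g f = f" "tmult X g g = g"
      unfolding f_def g_def
      using tmult_lift[of "r(i := a)", OF ra \<alpha>I] tmult_lift[of "r(i := b)", OF rb \<alpha>I] idem
      by simp_all
    moreover have "\<exists>!h. h \<in> transf_character X I P S \<and>
        tmult X (tmult X f h) f = f \<and> tmult X (tmult X h f) h = h"
      using inv in_T(1) unfolding inverse_semigroup_on_def by blast
    ultimately have "f = g" using in_T by metis
    moreover have "f a = a" "g a = b"
      using in_X[OF iI ab(1)] block_eq[OF iI ab(1)] fixed by (simp_all add: f_def g_def lift_def)
    ultimately show ?thesis by simp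
  qed
  then obtain a where "P i = {a}"
    using block_nonempty[OF iI] by blast
  then show ?thesis by simp
qed

end

text \<open>If \<open>\<alpha>\<beta>\<alpha> = \<alpha>\<close>, then \<open>\<beta>\<alpha>\<close> is idempotent and fixes every point of the image of \<open>\<alpha>\<close>.  This
  extends a condition on the images of idempotents to the images of all maps in \<open>S\<close>.\<close>

lemma inverse_semigroup_image_idempotent:
  assumes inv: "inverse_semigroup_on S (tmult Z)" and S: "S \<subseteq> transf Z" and \<alpha>: "\<alpha> \<in> S"
  obtains \<epsilon> where "\<epsilon> \<in> idempotents S (tmult Z)" "\<epsilon> ` Z = \<alpha> ` Z"
proof -
  obtain \<beta> where \<beta>: "\<beta> \<in> S" "tmult Z (tmult Z \<alpha> \<beta>) \<alpha> = \<alpha>"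
    using inv \<alpha> unfolding inverse_semigroup_on_def by blast
  have closed: "tmult Z f g \<in> S" if "f \<in> S" "g \<in> S" for f g
    using inv that unfolding inverse_semigroup_on_def semigroup_on_def by blast
  have assoc: "tmult Z (tmult Z f g) h = tmult Z f (tmult Z g h)"
    if "f \<in> S" "g \<in> S" "h \<in> S" for f g h
    using inv that unfolding inverse_semigroup_on_def semigroup_on_def by blast
  have "tmult Z (tmult Z \<beta> \<alpha>) (tmult Z \<beta> \<alpha>) = tmult Z \<beta> (tmult Z (tmult Z \<alpha> \<beta>) \<alpha>)"
    using \<alpha> \<beta>(1) by (simp add: assoc closed)
  then have "tmult Z \<beta> \<alpha> \<in> idempotents S (tmult Z)"
    using \<alpha> \<beta> by (simp add: idempotents_def closed)
  moreover have "tmult Z \<beta> \<alpha> ` Z = \<alpha> ` Z"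
  proof
    show "tmult Z \<beta> \<alpha> ` Z \<subseteq> \<alpha> ` Z"
      using \<beta>(1) S by (auto simp: tmult_apply transf_def)
    show "\<alpha> ` Z \<subseteq> tmult Z \<beta> \<alpha> ` Z"
    proof (rule image_subsetI)
      fix z assume z: "z \<in> Z"
      then have "\<alpha> z \<in> Z" using \<alpha> S by (auto simp: transf_def)
      moreover have "\<alpha> z = \<alpha> (\<beta> (\<alpha> z))" using \<beta>(2) z by (metis tmult_apply)
      ultimately show "\<alpha> z \<in> tmult Z \<beta> \<alpha> ` Z"
        by (metis imageI tmult_apply)
    qed
  qed
  ultimately show thesis by (rule that)
qed

theorem theorem3p10:
  fixes X :: "'a set" and I :: "'i set" and P :: "'i \<Rightarrow> 'a set" and S :: "('i \<Rightarrow> 'i) set"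
  assumes "X \<noteq> {}"
    and "indexed_partition X I P"
    and "subsemigroup_on S (transf I) (tmult I)"
  shows "inverse_semigroup_on (transf_character X I P S) (tmult X) \<longleftrightarrow>
           inverse_semigroup_on S (tmult I) \<and>
           (\<forall>\<alpha>\<in>idempotents S (tmult I). \<forall>i\<in>\<alpha> ` I. card (P i) = 1)"
proof -
  interpret partitioned_set X I P by (rule partitioned_set.intro) (rule assms(2))
  let ?T = "transf_character X I P S" and ?\<chi> = "character I P"
  have S: "S \<subseteq> transf I" using assms(3) by (simp add: subsemigroup_on_def)
  obtain r where r: "\<And>j. j \<in> I \<Longrightarrow> r j \<in> P j"
    by (rule representatives) blast
  have \<chi>_mem: "?\<chi> f \<in> S" if "f \<in> ?T" for f
    using that by (simp add: transf_character_def)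
  have \<chi>_mult: "?\<chi> (tmult X f g) = tmult I (?\<chi> f) (?\<chi> g)" if "f \<in> ?T" "g \<in> ?T" for f g
    using that by (simp add: transf_character_def tmult_transf_partition)
  have lift_mem: "lift r \<alpha> \<in> ?T" and \<chi>_lift: "?\<chi> (lift r \<alpha>) = \<alpha>" if "\<alpha> \<in> S" for \<alpha>
    using that S lift_transf_partition[of r \<alpha>, OF r] by (auto simp: transf_character_def)
  have lift_mult: "lift r (tmult I \<alpha> \<beta>) = tmult X (lift r \<alpha>) (lift r \<beta>)"
    if "\<alpha> \<in> S" "\<beta> \<in> S" for \<alpha> \<beta>
    using tmult_lift[of r \<alpha>, OF r] that S by auto
  show ?thesis
  proof (intro iffI conjI ballI)
    assume inv: "inverse_semigroup_on ?T (tmult X)"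
    show "inverse_semigroup_on S (tmult I)"
      by (rule inverse_semigroup_retract[where \<phi> = ?\<chi> and \<sigma> = "lift r", OF inv])
        (fact \<chi>_mem \<chi>_mult lift_mem lift_mult \<chi>_lift)+
    show "card (P i) = 1" if "\<alpha> \<in> idempotents S (tmult I)" "i \<in> \<alpha> ` I" for \<alpha> i
      using idempotent_image_singleton[OF S inv that] .
  next
    assume *: "inverse_semigroup_on S (tmult I) \<and>
      (\<forall>\<alpha>\<in>idempotents S (tmult I). \<forall>i\<in>\<alpha> ` I. card (P i) = 1)"
    then have inv: "inverse_semigroup_on S (tmult I)" by simp
    have singleton: "card (P i) = 1" if "\<alpha> \<in> S" "i \<in> \<alpha> ` I" for \<alpha> i
      using inverse_semigroup_image_idempotent[OF inv S that(1)] * that(2) by metis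
    have lift_\<chi>: "lift r (?\<chi> f) = f" if "f \<in> ?T" for f
      using that singleton[of "?\<chi> f"] lift_character[of r f, OF r]
      by (simp add: transf_character_def)
    show "inverse_semigroup_on ?T (tmult X)"
      by (rule inverse_semigroup_retract[where \<phi> = "lift r" and \<sigma> = ?\<chi>, OF inv])
        (fact \<chi>_mem \<chi>_mult lift_mem lift_mult lift_\<chi>)+
  qed
qed

end
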